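(* Let $k\geq 3$ be an integer and let $G$ be a 2-connected graph with minimum degree $\delta(G)\geq 2k+1$. Then $|L_e(G)|\geq k$. Moreover, if $|L_e(G)|=k$, then $2|L_e(G)|+2=\ell_e(G)$, and either $K_{2k+2}\subseteq G$ or $\chi(G)\leq 2k+1$.
   Context: All graphs are finite, simple and undirected. $L_e(G)$ denotes the set of all even integers $m$ such that $G$ contains a cycle of length $m$. $\ell_e(G)$ denotes the length of a longest even cycle in $G$ (when $G$ contains an even cycle). $\chi(G)$ is the chromatic number. $K_{m}\subseteq G$ means that $G$ contains a complete subgraph on $m$ vertices. *)

theory Defs
  imports "Graph_Theory.Graph_Theory"
begin

text \<open>
  A finite simple undirected graph is a \<open>graph\<close> in the sense of the locale of that name: a finite
  loop-free symmetric digraph without parallel arcs, where an undirected edge is a pair of opposite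
  arcs.  Hence the degree of a vertex is its out-degree.
\<close>

definition min_degree :: "('a, 'b) pre_digraph \<Rightarrow> nat" where
  "min_degree G = Min (out_degree G ` verts G)"

definition k_connected :: "nat \<Rightarrow> ('a, 'b) pre_digraph \<Rightarrow> bool" where
  "k_connected n G \<longleftrightarrow>
    n < card (verts G) \<and>
    (\<forall>X. X \<subseteq> verts G \<and> card X < n \<longrightarrow> connected (G \<restriction> (verts G - X)))"

text \<open>
  \<^const>\<open>pre_digraph.cycle\<close> requires pairwise distinct vertices, but it also accepts
  \<open>u \<rightarrow> v \<rightarrow> u\<close>, which is not a cycle of an undirected graph; such walks of length two are
  excluded by the bound on the length.
\<close>

definition even_cycle_lengths :: "('a, 'b) pre_digraph \<Rightarrow> nat set" where
  "even_cycle_lengths G =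
    {m. even m \<and> (\<exists>p. pre_digraph.cycle G p \<and> 3 \<le> length p \<and> length p = m)}"

text \<open>Only meaningful if the finite graph \<open>G\<close> has an even cycle.\<close>

definition longest_even_cycle_length :: "('a, 'b) pre_digraph \<Rightarrow> nat" where
  "longest_even_cycle_length G = Max (even_cycle_lengths G)"

definition proper_colouring :: "('a, 'b) pre_digraph \<Rightarrow> nat \<Rightarrow> ('a \<Rightarrow> nat) \<Rightarrow> bool" where
  "proper_colouring G n c \<longleftrightarrow>
    (\<forall>v \<in> verts G. c v < n) \<and> (\<forall>(u, v) \<in> arcs_ends G. c u \<noteq> c v)"

definition chromatic_number :: "('a, 'b) pre_digraph \<Rightarrow> nat" where
  "chromatic_number G = (LEAST n. \<exists>c. proper_colouring G n c)"

definition contains_complete :: "nat \<Rightarrow> ('a, 'b) pre_digraph \<Rightarrow> bool" where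
  "contains_complete m G \<longleftrightarrow> (\<exists>H. subgraph H G \<and> complete_digraph m H)"

end

theory Submission
  imports Defs
begin

text \<open>
  Write \<open>L\<close> for the set of even cycle lengths and let \<open>v\<^sub>0 \<dots> v\<^sub>p\<close> be a longest path.  All neighbours of
  \<open>v\<^sub>0\<close> lie on it, and two neighbours \<open>v\<^sub>i, v\<^sub>j\<close> with \<open>i < j\<close> of equal parity close a cycle of length
  \<open>j - i + 2\<close>.  Among at least \<open>2k + 1\<close> positions some \<open>k + 1\<close> have equal parity, so \<open>L\<close> has at least
  \<open>k\<close> elements.  If it has exactly \<open>k\<close>, then those positions form an arithmetic progression and the
  other parity class misses at most one term of one.  Applying this to the Posa rotations of the path
  yields a 4-cycle, so the progressions have step 2 and \<open>L = {4, 6, \<dots>, 2k + 2}\<close>.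

  Now choose the longest path such that the last position \<open>m\<close> of a neighbour of \<open>v\<^sub>0\<close> is as large as
  possible.  For \<open>m \<ge> 2k + 4\<close>, the many neighbours of \<open>v\<^sub>0\<close> and of the rotated end \<open>v\<^bsub>m-1\<^esub>\<close> produce a
  cycle of length \<open>2k + 4\<close>; hence \<open>m \<le> 2k + 2\<close>.  Then each of \<open>v\<^sub>0, \<dots>, v\<^bsub>m-1\<^esub>\<close> is a rotated end, so these
  vertices have all their neighbours among \<open>v\<^sub>0, \<dots>, v\<^sub>m\<close>.  As \<open>v\<^sub>m\<close> is not a cut vertex, \<open>G\<close> has at most
  \<open>2k + 3\<close> vertices, and its non-edges form a matching.
\<close>

section \<open>Finite sets and arithmetic progressions\<close>

text \<open>Here \<open>A\<close> will hold the candidate neighbour positions and \<open>B\<close>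
  the actual ones, so that at most one candidate is missing.\<close>

lemma mem_if_card_le_Suc:
  assumes "finite A" "B \<subseteq> A" "card A \<le> Suc (card B)" "a \<in> A" "b \<in> A" "a \<noteq> b"
  shows "a \<in> B \<or> b \<in> B"
proof (rule ccontr)
  assume "\<not> ?thesis"
  then have "B \<subseteq> A - {a, b}"
    using assms(2) by auto
  then have "card B \<le> card (A - {a, b})"
    using assms(1) by (intro card_mono) auto
  also have "\<dots> = card A - 2"
    using assms by (subst card_Diff_subset) auto
  finally show False
    using assms(3) card_mono[of A "{a, b}"] assms by auto
qed

text \<open>Repeated subtraction of \<open>Min D\<close> stays in \<open>D\<close>, so it never
  drops below \<open>Min D\<close> and can end only there. Hence every element is a multiple of
  \<open>Min D\<close> and all smaller multiples are met on the way; starting from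
  \<open>Max D\<close> meets them all.\<close>

lemma progression_if_closed_diff_Min:
  fixes D :: "nat set"
  assumes fin: "finite D" and ne: "D \<noteq> {}" and pos: "0 \<notin> D"
    and closed: "\<And>d. d \<in> D \<Longrightarrow> d \<noteq> Min D \<Longrightarrow> d - Min D \<in> D"
  shows "D = (\<lambda>j. Min D * j) ` {1..card D}"
proof -
  let ?t = "Min D"
  have t: "?t \<in> D"
    using fin ne by simp
  with pos have t0: "?t > 0"
    by (metis neq0_conv)
  have mult: "\<exists>j\<ge>1. d = ?t * j \<and> (\<forall>i\<in>{1..j}. ?t * i \<in> D)" if "d \<in> D" for d
    using that
  proof (induction d rule: less_induct)
    case (less d)
    show ?case
    proof (cases "d = ?t")
      case True
      have "\<forall>i\<in>{1..1}. ?t * i \<in> D" using t by simp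
      with True show ?thesis by (intro exI[of _ 1]) auto
    next
      case False
      have le: "?t \<le> d" using fin less.prems by simp
      obtain j where j: "j \<ge> 1" "d - ?t = ?t * j" "\<forall>i\<in>{1..j}. ?t * i \<in> D"
        using less.IH[of "d - ?t"] closed[OF less.prems False] t0 le by auto
      have d: "d = ?t * Suc j" using j(2) le by simp
      moreover have "\<forall>i\<in>{1..Suc j}. ?t * i \<in> D"
        using j(3) d less.prems by (auto simp: le_Suc_eq)
      ultimately show ?thesis by (intro exI[of _ "Suc j"]) auto
    qed
  qed
  obtain J where J: "J \<ge> 1" "Max D = ?t * J" "\<forall>i\<in>{1..J}. ?t * i \<in> D"
    using mult[of "Max D"] fin ne by auto
  have "D \<subseteq> (\<lambda>j. ?t * j) ` {1..J}"
  proof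
    fix d assume d: "d \<in> D"
    obtain j where "j \<ge> 1" "d = ?t * j" using mult[OF d] by auto
    moreover have "d \<le> Max D" using fin d by simp
    ultimately show "d \<in> (\<lambda>j. ?t * j) ` {1..J}" using J t0 by auto
  qed
  then have eq: "D = (\<lambda>j. ?t * j) ` {1..J}" using J by auto
  moreover have "card ((\<lambda>j. ?t * j) ` {1..J}) = J"
    using t0 by (subst card_image) (auto simp: inj_on_def)
  ultimately show ?thesis by metis
qed

section \<open>Longest paths and the neighbour positions of their first vertex\<close>

text \<open>
  \<open>L\<close> may be any finite set that contains the lengths of all even cycles; a cycle is given here by its
  list of vertices.
\<close>

locale dense_graph =
  fixes V :: "'a set" and adj :: "'a \<Rightarrow> 'a \<Rightarrow> bool" and k :: nat and L :: "nat set"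
  assumes finite_V: "finite V" and V_ne: "V \<noteq> {}"
    and adj_sym: "adj u v \<Longrightarrow> adj v u"
    and adj_irrefl: "\<not> adj v v"
    and adj_V: "adj u v \<Longrightarrow> v \<in> V"
    and degree: "v \<in> V \<Longrightarrow> 2 * k + 1 \<le> card {w. adj v w}"
    and finite_L: "finite L"
    and cycle_L: "\<lbrakk>distinct vs; successively adj vs; adj (last vs) (hd vs); 4 \<le> length vs;
      even (length vs)\<rbrakk> \<Longrightarrow> length vs \<in> L"
begin

definition path :: "'a list \<Rightarrow> bool" where
  "path P \<longleftrightarrow> P \<noteq> [] \<and> distinct P \<and> set P \<subseteq> V \<and> successively adj P"

definition longest :: "'a list \<Rightarrow> bool" where
  "longest P \<longleftrightarrow> path P \<and> (\<forall>Q. path Q \<longrightarrow> length Q \<le> length P)"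

definition nbrs :: "'a list \<Rightarrow> nat set" where
  "nbrs P = {i. i < length P \<and> adj (P ! 0) (P ! i)}"

definition par_nbrs :: "'a list \<Rightarrow> bool \<Rightarrow> nat set" where
  "par_nbrs P b = {i \<in> nbrs P. even i = b}"

text \<open>Posa rotation: if \<open>x\<close> is a neighbour position, the edge from
  \<open>P ! 0\<close> to \<open>P ! x\<close> replaces the one from \<open>P ! (x - 1)\<close> to
  \<open>P ! x\<close>, and \<open>P ! (x - 1)\<close> comes first.\<close>

definition rot :: "nat \<Rightarrow> 'a list \<Rightarrow> 'a list" where
  "rot x P = rev (take x P) @ drop x P"

lemma path_length_le: "path P \<Longrightarrow> length P \<le> card V"
  unfolding path_def using finite_V by (metis card_mono distinct_card)

lemma ex_longest: "\<exists>P. longest P"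
proof -
  obtain v where "v \<in> V" using V_ne by auto
  then have "path [v]" by (simp add: path_def)
  then show ?thesis
    using ex_has_greatest_nat[of path "[v]" length "Suc (card V)"] path_length_le
    unfolding longest_def by (auto simp: le_imp_less_Suc)
qed

lemma path_step: "path P \<Longrightarrow> Suc i < length P \<Longrightarrow> adj (P ! i) (P ! Suc i)"
  by (simp add: path_def successively_conv_nth)

lemma path_successively_upt:
  assumes "path P" "b \<le> length P"
  shows "successively (\<lambda>i j. adj (P ! i) (P ! j)) [a..<b]"
  using assms by (auto simp: successively_conv_nth intro!: path_step)

text \<open>Lets a cycle be given by positions on a path, so that distinctness and length become
  arithmetic.\<close>

lemma index_cycle_L:
  assumes "path P" "distinct is" "set is \<subseteq> {..<length P}"
    and "successively (\<lambda>i j. adj (P ! i) (P ! j)) is"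
    and "adj (P ! last is) (P ! hd is)" "4 \<le> length is" "even (length is)"
  shows "length is \<in> L"
proof -
  have "is \<noteq> []" using assms(6) by auto
  moreover have "inj_on ((!) P) (set is)"
    using assms(1,3) unfolding path_def by (intro inj_on_nth) auto
  ultimately show ?thesis
    using cycle_L[of "map ((!) P) is"] assms
    by (simp add: distinct_map successively_map last_map hd_map)
qed

lemma longest_path: "longest P \<Longrightarrow> path P"
  by (simp add: longest_def)

lemma longest_hd_nbr:
  assumes "longest P" "adj (P ! 0) w"
  shows "w \<in> set P"
proof (rule ccontr)
  assume "w \<notin> set P"
  then have "path (w # P)"
    using assms adj_V adj_sym unfolding longest_def path_def
    by (auto simp: successively_Cons hd_conv_nth)
  then show False
    using assms(1) unfolding longest_def by fastforce
qed

lemma finite_nbrs [simp]: "finite (nbrs P)" "finite (par_nbrs P b)"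
  by (auto simp: nbrs_def par_nbrs_def)

lemma nbrs_length: "i \<in> nbrs P \<Longrightarrow> i < length P"
  by (simp add: nbrs_def)

lemma nbrs_adj: "i \<in> nbrs P \<Longrightarrow> adj (P ! 0) (P ! i)"
  by (simp add: nbrs_def)

lemma nbrs_pos: "i \<in> nbrs P \<Longrightarrow> 1 \<le> i"
  using adj_irrefl by (cases i) (auto simp: nbrs_def)

lemma card_nbrs:
  assumes "longest P"
  shows "2 * k + 1 \<le> card (nbrs P)"
proof -
  have "P \<noteq> []" "set P \<subseteq> V" using assms by (auto simp: longest_def path_def)
  then have "P ! 0 \<in> V" by auto
  then have "2 * k + 1 \<le> card {w. adj (P ! 0) w}" by (rule degree)
  also have "{w. adj (P ! 0) w} \<subseteq> (!) P ` nbrs P"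
    using longest_hd_nbr[OF assms] by (fastforce simp: nbrs_def in_set_conv_nth)
  then have "card {w. adj (P ! 0) w} \<le> card (nbrs P)"
    by (meson card_image_le card_mono finite_imageI finite_nbrs(1) order_trans)
  finally show ?thesis .
qed

lemma one_in_nbrs:
  assumes "longest P"
  shows "1 \<in> nbrs P"
proof -
  have "nbrs P \<noteq> {}" using card_nbrs[OF assms] by auto
  then obtain i where "i \<in> nbrs P" by auto
  then have "1 < length P" using nbrs_pos nbrs_length by fastforce
  then show ?thesis
    using path_step[OF longest_path[OF assms], of 0] by (simp add: nbrs_def)
qed

lemma par_nbrs_diff_L:
  assumes P: "longest P" and ij: "i \<in> par_nbrs P b" "j \<in> par_nbrs P b" "i < j"
  shows "j - i + 2 \<in> L"
proof -
  have i: "i \<in> nbrs P" "even i = b" and j: "j \<in> nbrs P" "even j = b"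
    using ij by (auto simp: par_nbrs_def)
  have l: "j < length P" using j nbrs_length by auto
  have "successively (\<lambda>i j. adj (P ! i) (P ! j)) (0 # [i..<Suc j])"
    using path_successively_upt[OF longest_path[OF P], of "Suc j" i] l nbrs_adj[OF i(1)] ij(3)
    by (auto simp: successively_Cons simp del: upt_Suc)
  \<comment> \<open>Equal parity excludes consecutive positions, so the cycle has at least 4
    vertices.\<close>
  moreover have "2 \<le> j - i" using i(2) j(2) ij(3) by (cases "j = Suc i") auto
  moreover have "even (j - i)" using i(2) j(2) by auto
  ultimately have "length (0 # [i..<Suc j]) \<in> L"
    using longest_path[OF P] nbrs_pos[OF i(1)] nbrs_adj[OF j(1)] adj_sym ij(3) l
    by (intro index_cycle_L) (auto simp del: upt_Suc simp: Suc_diff_le)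
  then show ?thesis using ij(3) by (simp add: Suc_diff_le)
qed

text \<open>The shift by 2 turns cycle lengths into distances between neighbour positions of equal
  parity.\<close>

definition gaps :: "nat set" where
  "gaps = {d. 0 < d \<and> d + 2 \<in> L}"

lemma par_nbrs_diff_gaps:
  assumes "longest P" "i \<in> par_nbrs P b" "j \<in> par_nbrs P b" "i < j"
  shows "j - i \<in> gaps"
  using par_nbrs_diff_L[OF assms] assms(4) by (simp add: gaps_def)

lemma finite_gaps: "finite gaps"
proof (rule finite_subset)
  show "gaps \<subseteq> (\<lambda>n. n - 2) ` L"
    unfolding gaps_def by (auto simp: image_iff intro!: bexI[rotated])
qed (simp add: finite_L)

lemma card_gaps: "card gaps \<le> card L"
  by (rule card_inj_on_le[of "\<lambda>d. d + 2"]) (auto simp: gaps_def finite_L inj_on_def)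

lemma card_par_nbrs_Min:
  assumes "par_nbrs P b \<noteq> {}"
  shows "card ((\<lambda>i. i - Min (par_nbrs P b)) ` (par_nbrs P b - {Min (par_nbrs P b)})) + 1 = card (par_nbrs P b)"
proof -
  have "card ((\<lambda>i. i - Min (par_nbrs P b)) ` (par_nbrs P b - {Min (par_nbrs P b)}))
      = card (par_nbrs P b - {Min (par_nbrs P b)})"
    by (rule card_image) (auto intro!: inj_on_diff_nat)
  then show ?thesis
    using assms by (metis Min_in Suc_eq_plus1 card_Suc_Diff1 finite_nbrs(2))
qed

lemma par_nbrs_Min_gaps:
  assumes "longest P"
  shows "(\<lambda>i. i - Min (par_nbrs P b)) ` (par_nbrs P b - {Min (par_nbrs P b)}) \<subseteq> gaps"
proof (rule image_subsetI)
  fix i assume "i \<in> par_nbrs P b - {Min (par_nbrs P b)}"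
  then have i: "i \<in> par_nbrs P b" "i \<noteq> Min (par_nbrs P b)"
    by auto
  then have "Min (par_nbrs P b) \<in> par_nbrs P b" "Min (par_nbrs P b) < i"
    using Min_in[of "par_nbrs P b"] Min_le[of "par_nbrs P b" i]
    by (auto simp: order_less_le simp del: Min_in)
  then show "i - Min (par_nbrs P b) \<in> gaps"
    using par_nbrs_diff_gaps[OF assms _ i(1)] by blast
qed

text \<open>Subtracting the least position of a class maps the others injectively into
  \<open>gaps\<close>.\<close>

lemma card_par_nbrs_le:
  assumes "longest P"
  shows "card (par_nbrs P b) \<le> card gaps + 1"
proof (cases "par_nbrs P b = {}")
  case False
  then show ?thesis
    using card_mono[OF finite_gaps par_nbrs_Min_gaps[OF assms, of b]] card_par_nbrs_Min[OF False] by linarith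
qed auto

lemma card_both_par_nbrs: 
  assumes "longest P"
  shows "2 * k + 1 \<le> card (par_nbrs P True) + card (par_nbrs P False)"
proof -
  have "card (par_nbrs P True) + card (par_nbrs P False) = card (nbrs P)"
    by (subst card_Un_disjoint[symmetric]) (auto simp: par_nbrs_def intro!: arg_cong[of _ _ card])
  then show ?thesis using card_nbrs[OF assms] by simp
qed

theorem card_L: "k \<le> card L"
proof -
  obtain P where P: "longest P" using ex_longest by auto
  show ?thesis
    using card_both_par_nbrs[OF P] card_par_nbrs_le[OF P, of True] card_par_nbrs_le[OF P, of False]
      card_gaps by linarith
qed

section \<open>Posa rotations\<close>

lemma length_rot [simp]: "length (rot x P) = length P"
  by (simp add: rot_def)

lemma set_rot [simp]: "set (rot x P) = set P"
  unfolding rot_def by (metis append_take_drop_id set_append set_rev)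

lemma nth_rot: "x \<le> length P \<Longrightarrow> i < length P \<Longrightarrow> rot x P ! i = P ! (if i < x then x - 1 - i else i)"
  by (auto simp: rot_def nth_append rev_nth)

lemma longest_rot:
  assumes "longest P" "x \<in> nbrs P"
  shows "longest (rot x P)"
proof -
  have P: "path P" using assms by (simp add: longest_def)
  have x: "1 \<le> x" "x < length P" using assms nbrs_pos nbrs_length by auto
  have d: "distinct (rot x P)"
    using P unfolding path_def rot_def
    by (metis append_take_drop_id distinct_append distinct_rev set_rev)
  have "successively adj (take x P)" "successively adj (drop x P)"
    using P unfolding path_def by (metis append_take_drop_id successively_append_iff)+
  then have "successively (\<lambda>u v. adj v u) (take x P)" "successively adj (drop x P)"
    by (auto elim: successively_mono intro: adj_sym)
  moreover have "hd P = P ! 0" "P \<noteq> []" using x by (auto intro!: hd_conv_nth)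
  ultimately have "successively adj (rot x P)"
    using x nbrs_adj[OF assms(2)] unfolding rot_def
    by (simp add: successively_append_iff last_rev hd_drop_conv_nth)
  then have "path (rot x P)"
    using d P x by (auto simp: path_def simp flip: length_0_conv)
  then show ?thesis using assms(1) by (simp add: longest_def)
qed

lemma rot_nth_0:
  assumes "x \<in> nbrs P"
  shows "rot x P ! 0 = P ! (x - 1)"
  using nbrs_pos[OF assms] nbrs_length[OF assms] by (subst nth_rot) auto

text \<open>Sending \<open>j < x\<close> to \<open>x - 1 - j\<close> is an involution, so one
  formula translates positions on \<open>P\<close> to those on \<open>rot x P\<close> and
  back.\<close>

lemma nbrs_rot_iff:
  assumes "x \<in> nbrs P" "j < length P"
  shows "adj (P ! (x - 1)) (P ! j) \<longleftrightarrow> (if j < x then x - 1 - j else j) \<in> nbrs (rot x P)"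
proof -
  have x: "1 \<le> x" "x < length P"
    using nbrs_pos[OF assms(1)] nbrs_length[OF assms(1)] by auto
  note rot_nth_0[OF assms(1)]
  moreover have "rot x P ! (if j < x then x - 1 - j else j) = P ! j"
    using x assms(2) by (subst nth_rot) auto
  ultimately show ?thesis
    using x assms(2) by (auto simp: nbrs_def simp del: One_nat_def)
qed

end

section \<open>The extremal case: neighbour positions in arithmetic progression\<close>

locale extremal_graph = dense_graph +
  assumes card_L_eq: "card L = k" and k_ge_3: "3 \<le> k"
begin

lemma card_par_nbrs_le_k: "longest P \<Longrightarrow> card (par_nbrs P b) \<le> k + 1"
  using card_par_nbrs_le[of P b] card_gaps card_L_eq by linarith

lemma card_par_nbrs_ge_k:
  assumes "longest P"
  shows "k \<le> card (par_nbrs P b)"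
  using card_both_par_nbrs[OF assms] card_par_nbrs_le_k[OF assms, of True]
    card_par_nbrs_le_k[OF assms, of False] by (cases b) auto

lemma full_par_nbrs:
  assumes "longest P"
  shows "card (par_nbrs P True) = k + 1 \<or> card (par_nbrs P False) = k + 1"
  using card_both_par_nbrs[OF assms] card_par_nbrs_le_k[OF assms, of True]
    card_par_nbrs_le_k[OF assms, of False] by linarith

text \<open>A full class has \<open>k\<close> distances from its least position, all in
  \<open>gaps\<close>, which has at most \<open>k\<close> elements.\<close>

lemma gaps_if_full:
  assumes "longest P" "card (par_nbrs P b) = k + 1"
  shows "gaps = (\<lambda>i. i - Min (par_nbrs P b)) ` (par_nbrs P b - {Min (par_nbrs P b)})"
    and "card gaps = k"
proof -
  have ne: "par_nbrs P b \<noteq> {}" using assms(2) by auto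
  have "card gaps \<le> k" using card_gaps card_L_eq by simp
  then show "gaps = (\<lambda>i. i - Min (par_nbrs P b)) ` (par_nbrs P b - {Min (par_nbrs P b)})"
    using card_seteq[OF finite_gaps par_nbrs_Min_gaps[OF assms(1)], of b]
      card_par_nbrs_Min[OF ne] assms(2) by simp
  then show "card gaps = k"
    using card_par_nbrs_Min[OF ne] assms(2) by simp
qed

definition step :: nat where
  "step = Min gaps"

text \<open>Every gap is a distance \<open>f - Min ?F\<close> in a full class \<open>?F\<close>.
  Subtracting \<open>step = f1 - Min ?F\<close> leaves \<open>f - f1\<close>, again a distance in
  the class and so a gap; hence \<open>gaps\<close> is closed as
  \<open>progression_if_closed_diff_Min\<close> requires.\<close>

lemma gaps_step: "gaps = (\<lambda>j. step * j) ` {1..k}" and even_step: "even step"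
  and step_pos: "0 < step"
proof -
  obtain P b where P: "longest P" "card (par_nbrs P b) = k + 1"
    using ex_longest full_par_nbrs by blast
  let ?F = "par_nbrs P b"
  note gaps = gaps_if_full[OF P]
  have F: "?F \<noteq> {}" using P(2) by auto
  then have f0: "Min ?F \<in> ?F" by (intro Min_in) auto
  have ge: "Min ?F \<le> i" if "i \<in> ?F" for i using that by simp
  have ne: "gaps \<noteq> {}" using gaps(2) k_ge_3 by auto
  then have "step \<in> gaps"
    unfolding step_def using finite_gaps by simp
  then show "0 < step" by (simp add: gaps_def)
  obtain f1 where f1: "f1 \<in> ?F" "step = f1 - Min ?F"
    using \<open>step \<in> gaps\<close> gaps(1) by auto
  then show "even step"
    using f0 by (auto simp: par_nbrs_def)
  have "d - step \<in> gaps" if d: "d \<in> gaps" "d \<noteq> step" for d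
  proof -
    obtain f where f: "f \<in> ?F" "d = f - Min ?F"
      using d(1) gaps(1) by auto
    have "step \<le> d" using d(1) finite_gaps by (simp add: step_def)
    then have "f1 < f" using f1(2) f(2) d(2) ge[OF f1(1)] ge[OF f(1)] by linarith
    moreover have "d - step = f - f1"
      using f1(2) f(2) ge[OF f1(1)] ge[OF f(1)] by linarith
    ultimately show ?thesis
      using par_nbrs_diff_gaps[OF P(1) f1(1) f(1)] by simp
  qed
  then show "gaps = (\<lambda>j. step * j) ` {1..k}"
    using progression_if_closed_diff_Min[OF finite_gaps ne] gaps(2)
    unfolding step_def by (simp add: gaps_def)
qed

lemma par_nbrs_step:
  assumes "longest P" "i \<in> par_nbrs P b" "j \<in> par_nbrs P b" "i \<le> j"
  obtains q where "q \<le> k" "j = i + step * q"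
proof (cases "i = j")
  case False
  then have "j - i \<in> gaps" using par_nbrs_diff_gaps assms by simp
  then show ?thesis
    unfolding gaps_step using that assms(4) by auto
qed (use that[of 0] in simp)

lemma full_par_nbrs_eq:
  assumes "longest P" "card (par_nbrs P b) = k + 1"
  shows "par_nbrs P b = (\<lambda>q. Min (par_nbrs P b) + step * q) ` {0..k}"
proof (rule card_seteq)
  have Min: "Min (par_nbrs P b) \<in> par_nbrs P b"
    using assms(2) by (intro Min_in) auto
  show "par_nbrs P b \<subseteq> (\<lambda>q. Min (par_nbrs P b) + step * q) ` {0..k}"
  proof
    fix j assume j: "j \<in> par_nbrs P b"
    then have "Min (par_nbrs P b) \<le> j" by simp
    then obtain q where "q \<le> k" "j = Min (par_nbrs P b) + step * q"
      using par_nbrs_step[OF assms(1) Min j] by metis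
    then show "j \<in> (\<lambda>q. Min (par_nbrs P b) + step * q) ` {0..k}"
      by auto
  qed
  show "card ((\<lambda>q. Min (par_nbrs P b) + step * q) ` {0..k}) \<le> card (par_nbrs P b)"
    using card_image_le[of "{0..k}" "\<lambda>q. Min (par_nbrs P b) + step * q"] assms(2) by simp
qed simp

lemma one_in_par_nbrs: "longest P \<Longrightarrow> 1 \<in> par_nbrs P False"
  using one_in_nbrs by (simp add: par_nbrs_def)

text \<open>Position 1 is always taken, which fixes the start of the odd progression for every
  longest path.\<close>

lemma odd_par_nbrs_subset:
  assumes "longest P"
  shows "par_nbrs P False \<subseteq> (\<lambda>q. 1 + step * q) ` {0..k}"
proof
  fix j assume j: "j \<in> par_nbrs P False"
  then have "1 \<le> j" using nbrs_pos[of j P] by (simp add: par_nbrs_def)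
  then obtain q where "q \<le> k" "j = 1 + step * q"
    using par_nbrs_step[OF assms one_in_par_nbrs[OF assms] j] by blast
  then show "j \<in> (\<lambda>q. 1 + step * q) ` {0..k}" by auto
qed

lemma odd_nbrs:
  assumes "longest P" "q \<le> k" "r \<le> k" "q \<noteq> r"
  shows "1 + step * q \<in> nbrs P \<or> 1 + step * r \<in> nbrs P"
proof -
  have "card ((\<lambda>q. 1 + step * q) ` {0..k}) \<le> Suc (card (par_nbrs P False))"
    using card_image_le[of "{0..k}" "\<lambda>q. 1 + step * q"] card_par_nbrs_ge_k[OF assms(1), of False]
    by simp
  moreover have "1 + step * q \<noteq> 1 + step * r"
    using assms(4) step_pos by simp
  ultimately show ?thesis
    using mem_if_card_le_Suc[OF _ odd_par_nbrs_subset[OF assms(1)], of "1 + step * q" "1 + step * r"]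
      assms(2,3) by (auto simp: par_nbrs_def)
qed

lemma par_nbrs_imageD:
  assumes "par_nbrs P b = f ` A" "a \<in> A"
  shows "f a \<in> nbrs P" "even (f a) = b"
proof -
  have "f a \<in> par_nbrs P b" using assms by simp
  then show "f a \<in> nbrs P" "even (f a) = b" by (simp_all add: par_nbrs_def)
qed

section \<open>A 4-cycle, and the exact value of \<open>L\<close>\<close>

lemma four_cycle:
  assumes "u \<noteq> w" "x \<noteq> y" "adj u x" "adj w x" "adj u y" "adj w y"
  shows "4 \<in> L"
proof -
  have "length [u, x, w, y] \<in> L"
    using assms adj_irrefl adj_sym by (intro cycle_L) auto
  then show ?thesis by (simp add: eval_nat_numeral)
qed

lemma nbrs_rot_adj:
  assumes "x \<in> nbrs P" "i \<in> nbrs (rot x P)"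
  shows "adj (P ! (x - 1)) (P ! (if i < x then x - 1 - i else i))"
proof -
  have "i < length P" using assms(2) nbrs_length by fastforce
  then show ?thesis
    using nbrs_rot_iff[OF assms(1), of "if i < x then x - 1 - i else i"]
      nbrs_length[OF assms(1)] assms(2) by (auto split: if_splits)
qed

lemma longest_nth_eq: "longest P \<Longrightarrow> i < length P \<Longrightarrow> j < length P \<Longrightarrow> P ! i = P ! j \<longleftrightarrow> i = j"
  by (simp add: longest_def path_def nth_eq_iff_index_eq)

text \<open>After rotation at \<open>1 + step\<close> the first vertex is \<open>P ! step\<close>,
  and positions from \<open>1 + step\<close> on are unmoved. Of the three positions
  \<open>1 + step * r\<close> with \<open>r\<close> in 1, 2, 3 it has two as neighbours;
  \<open>P ! 0\<close> has all three, so two common neighbours close a 4-cycle.\<close>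

lemma four_if_odd_full:
  assumes P: "longest P" and full: "card (par_nbrs P False) = k + 1"
  shows "4 \<in> L"
proof -
  have eq: "par_nbrs P False = (\<lambda>q. 1 + step * q) ` {0..k}"
    using full odd_par_nbrs_subset[OF P] card_image_le[of "{0..k}" "\<lambda>q. 1 + step * q"]
    by (intro card_seteq) auto
  have X: "1 + step * q \<in> nbrs P" if "q \<le> k" for q
    using par_nbrs_imageD(1)[OF eq, of q] that by simp
  let ?R = "rot (1 + step) P"
  have x: "1 + step \<in> nbrs P" using X[of 1] k_ge_3 by simp
  have R: "longest ?R" using longest_rot[OF P x] .
  obtain r s where rs: "r \<in> {1,2,3}" "s \<in> {1,2,3}" "r \<noteq> s"
    "1 + step * r \<in> nbrs ?R" "1 + step * s \<in> nbrs ?R"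
    using odd_nbrs[OF R, of 1 2] odd_nbrs[OF R, of 1 3] odd_nbrs[OF R, of 2 3] k_ge_3
    by fastforce
  have rk: "r \<le> k" "s \<le> k" using rs k_ge_3 by auto
  have nl: "\<not> 1 + step * q < 1 + step" if "q \<in> {1,2,3}" for q using that by auto
  have "adj (P ! step) (P ! (1 + step * r))" "adj (P ! step) (P ! (1 + step * s))"
    using nbrs_rot_adj[OF x rs(4)] nbrs_rot_adj[OF x rs(5)]
    unfolding if_not_P[OF nl[OF rs(1)]] if_not_P[OF nl[OF rs(2)]] by simp_all
  moreover have "P ! 0 \<noteq> P ! step"
    using nbrs_length[OF x] step_pos by (subst longest_nth_eq[OF P]) auto
  moreover have "P ! (1 + step * r) \<noteq> P ! (1 + step * s)"
    using nbrs_length[OF X[OF rk(1)]] nbrs_length[OF X[OF rk(2)]] rs step_pos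
    by (subst longest_nth_eq[OF P]) auto
  ultimately show ?thesis
    using four_cycle[of "P ! 0" "P ! step" "P ! (1 + step * r)" "P ! (1 + step * s)"]
      nbrs_adj[OF X[OF rk(1)]] nbrs_adj[OF X[OF rk(2)]] by simp
qed

lemma step_nbr:
  assumes "longest P" "x \<in> nbrs P"
  shows "x \<in> nbrs (rot x P)"
  using path_step[OF longest_path[OF assms(1)], of "x - 1"] nbrs_pos[OF assms(2)]
    nbrs_length[OF assms(2)] nbrs_rot_iff[OF assms(2), of x] by simp

text \<open>A full class has no holes, so a term whose successor is missing is the last one and
  \<open>k\<close> terms precede it. The strict inequality records that the subtraction is not
  truncated.\<close>

lemma rot_even_full:
  assumes P: "longest P" "card (par_nbrs P True) = k + 1"
    and x: "x \<in> nbrs P" "even x" "x + step \<notin> nbrs P" "i < k + 1"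
  shows "step * i < x \<and> x - step * i \<in> nbrs P"
proof -
  obtain f where f: "par_nbrs P True = (\<lambda>q. f + step * q) ` {0..k}"
    using full_par_nbrs_eq[OF P] by blast
  have mem: "f + step * q \<in> nbrs P" if "q \<le> k" for q
    using par_nbrs_imageD(1)[OF f, of q] that by simp
  then have f0: "0 < f" using nbrs_pos[of "f" P] mem[of 0] by auto
  have "x \<in> par_nbrs P True" using x by (simp add: par_nbrs_def)
  then obtain q where q: "q \<le> k" "x = f + step * q" using f by auto
  have "q = k"
    using mem[of "Suc q"] q x(3) by (cases "q = k") (auto simp: algebra_simps)
  then have "x - step * i = f + step * (k - i)"
    using q x(4) by (auto simp: diff_mult_distrib2)
  then show ?thesis
    using mem[of "k - i"] f0 by auto
qed

lemma four_in_L: "4 \<in> L"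
proof (rule ccontr)
  text \<open>
    Let \<open>b\<close> be the first even neighbour position of \<open>P ! 0\<close>.  Without a 4-cycle, the progressions of the
    rotated ends \<open>P ! (b - 1)\<close> and \<open>P ! (b + step - 1)\<close> must stop at \<open>b\<close> and \<open>b + step\<close>; but then both
    ends are adjacent to \<open>P ! (step - 1)\<close> and \<open>P ! (2 * step - 1)\<close>.
  \<close>
  assume not4: "4 \<notin> L"
  \<comment> \<open>Without a 4-cycle no odd class is full, so every even class is.\<close>
  have full: "card (par_nbrs Q True) = k + 1" if "longest Q" for Q
    using full_par_nbrs[OF that] four_if_odd_full[OF that] not4 by auto
  obtain P where P: "longest P" using ex_longest by auto
  obtain b where b: "par_nbrs P True = (\<lambda>q. b + step * q) ` {0..k}"
    using full_par_nbrs_eq[OF P full[OF P]] by blast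
  have X: "b + step * q \<in> nbrs P" "even (b + step * q)" if "q \<le> k" for q
    using par_nbrs_imageD[OF b, of q] that by simp_all
  have b0: "b \<in> nbrs P" "even b" and b1: "b + step \<in> nbrs P" and b2: "b + 2 * step \<in> nbrs P"
    using X[of 0] X[of 1] X[of 2] k_ge_3 by (auto simp: mult.commute)
  note len = nbrs_length[OF b0(1)] nbrs_length[OF b1] nbrs_length[OF b2] nbrs_pos[OF b0(1)]
  let ?R = "rot b P" and ?S = "rot (b + step) P"
  note R = longest_rot[OF P b0(1)] and S = longest_rot[OF P b1]
  \<comment> \<open>\<open>P ! 0\<close> and \<open>P ! (b - 1)\<close> share the neighbour
    \<open>P ! b\<close>; a second common neighbour would close a 4-cycle.\<close>
  have no1: "b + step \<notin> nbrs ?R"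
  proof
    assume "b + step \<in> nbrs ?R"
    then have "adj (P ! (b - 1)) (P ! (b + step))" "adj (P ! (b - 1)) (P ! b)"
      using nbrs_rot_adj[OF b0(1), of "b + step"]
        nbrs_rot_adj[OF b0(1) step_nbr[OF P b0(1)]] by auto
    moreover have "P ! 0 \<noteq> P ! (b - 1)" "P ! b \<noteq> P ! (b + step)"
      using len step_pos b0(2) by (subst longest_nth_eq[OF P]; force)+
    ultimately show False
      using four_cycle[of "P ! 0" "P ! (b - 1)" "P ! b" "P ! (b + step)"]
        nbrs_adj[OF b0(1)] nbrs_adj[OF b1] not4 by simp
  qed
  have no2: "b + step + step \<notin> nbrs ?S"
  proof
    assume "b + step + step \<in> nbrs ?S"
    then have "adj (P ! (b + step - 1)) (P ! (b + 2 * step))"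
        "adj (P ! (b + step - 1)) (P ! (b + step))"
      using nbrs_rot_adj[OF b1, of "b + step + step"]
        nbrs_rot_adj[OF b1 step_nbr[OF P b1]] by (auto simp: mult_2 add.assoc)
    moreover have "P ! 0 \<noteq> P ! (b + step - 1)" "P ! (b + step) \<noteq> P ! (b + 2 * step)"
      using len step_pos b0(2) by (subst longest_nth_eq[OF P]; force)+
    ultimately show False
      using four_cycle[of "P ! 0" "P ! (b + step - 1)" "P ! (b + step)" "P ! (b + 2 * step)"]
        nbrs_adj[OF b1] nbrs_adj[OF b2] not4 by simp
  qed
  note r = rot_even_full[OF R full[OF R] step_nbr[OF P b0(1)] b0(2) no1]
  note s = rot_even_full[OF S full[OF S] step_nbr[OF P b1] _ no2]
  have r1: "step < b" "b - step \<in> nbrs ?R" and r2: "2 * step < b" "b - 2 * step \<in> nbrs ?R"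
    using r[of 1] r[of 2] k_ge_3 by (auto simp: mult.commute)
  have s1: "b \<in> nbrs ?S" and s2: "b - step \<in> nbrs ?S"
    using s[of 1] s[of 2] k_ge_3 even_step b0(2) by (auto simp: mult.commute)
  \<comment> \<open>Reflected back to \<open>P\<close>, the positions \<open>b - step\<close> and
    \<open>b - 2 * step\<close> on \<open>?R\<close>, and likewise \<open>b\<close> and
    \<open>b - step\<close> on \<open>?S\<close>, are \<open>step - 1\<close> and
    \<open>2 * step - 1\<close>.\<close>
  have "adj (P ! (b - 1)) (P ! (step - 1))" "adj (P ! (b - 1)) (P ! (2 * step - 1))"
    using nbrs_rot_adj[OF b0(1) r1(2)] nbrs_rot_adj[OF b0(1) r2(2)] r1(1) r2(1) step_pos by auto
  moreover have "adj (P ! (b + step - 1)) (P ! (step - 1))"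
  proof -
    have *: "b < b + step" "b + step - 1 - b = step - 1"
      using step_pos by auto
    show ?thesis
      using nbrs_rot_adj[OF b1 s1] unfolding if_P[OF *(1)] *(2) .
  qed
  moreover have "adj (P ! (b + step - 1)) (P ! (2 * step - 1))"
  proof -
    have *: "b - step < b + step" "b + step - 1 - (b - step) = 2 * step - 1"
      using r1(1) step_pos by auto
    show ?thesis
      using nbrs_rot_adj[OF b1 s2] unfolding if_P[OF *(1)] *(2) .
  qed
  moreover have "P ! (b - 1) \<noteq> P ! (b + step - 1)" "P ! (step - 1) \<noteq> P ! (2 * step - 1)"
    using len step_pos r2(1) by (subst longest_nth_eq[OF P]; force)+
  ultimately show False
    using four_cycle[of "P ! (b - 1)" "P ! (b + step - 1)" "P ! (step - 1)" "P ! (2 * step - 1)"]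
      not4 by simp
qed

lemma step_eq_2: "step = 2"
proof -
  have "2 \<in> gaps" using four_in_L by (simp add: gaps_def)
  then have "step \<le> 2" using finite_gaps by (simp add: step_def)
  then show ?thesis using step_pos even_step by (cases "step = 1") auto
qed

lemma L_eq: "L = (\<lambda>j. 2 * j + 2) ` {1..k}"
proof (rule card_seteq[symmetric])
  have "(\<lambda>j. 2 * j + 2) ` {1..k} = (\<lambda>d. d + 2) ` gaps"
    unfolding gaps_step step_eq_2 by (simp add: image_image)
  then show "(\<lambda>j. 2 * j + 2) ` {1..k} \<subseteq> L"
    by (auto simp: gaps_def)
  show "card L \<le> card ((\<lambda>j. 2 * j + 2) ` {1..k})"
    using card_L_eq by (subst card_image) (auto simp: inj_on_def)
qed (rule finite_L)

section \<open>The largest neighbour position\<close>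

definition widest :: "'a list \<Rightarrow> nat \<Rightarrow> bool" where
  "widest P m \<longleftrightarrow> longest P \<and> m \<in> nbrs P \<and> (\<forall>Q. longest Q \<longrightarrow> nbrs Q \<subseteq> {1..m})"

lemma ex_widest: "\<exists>P m. widest P m"
proof -
  let ?M = "\<Union>P\<in>Collect longest. nbrs P"
  have "?M \<subseteq> {..card V}"
    using nbrs_length path_length_le longest_path by fastforce
  then have fin: "finite ?M" by (rule finite_subset) simp
  have "?M \<noteq> {}" using ex_longest one_in_nbrs by blast
  then have "Max ?M \<in> ?M" using fin by (rule Max_in[rotated])
  then obtain P where P: "longest P" "Max ?M \<in> nbrs P" by auto
  have "i \<in> {1..Max ?M}" if "longest Q" "i \<in> nbrs Q" for Q i
    using that fin nbrs_pos[of i Q] by (auto intro!: Max_ge)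
  then show ?thesis
    using P unfolding widest_def by blast
qed

lemma L_le: "n \<in> L \<Longrightarrow> n \<le> 2 * k + 2"
  by (auto simp: L_eq)

text \<open>Odd positions count upwards from 1 and even ones downwards from \<open>m\<close>, both
  in steps of 2. This leaves at most \<open>2 * k + 2\<close> candidates, of which at least
  \<open>2 * k + 1\<close> are taken.\<close>

lemma widest_nbrs_cover:
  assumes "longest Q" "m \<in> nbrs Q" "nbrs Q \<subseteq> {1..m}" "even m"
    and ab: "a \<noteq> b" "odd a \<and> a \<le> 2 * k + 1 \<or> even a \<and> m \<le> a + 2 * k \<and> a \<le> m"
      "odd b \<and> b \<le> 2 * k + 1 \<or> even b \<and> m \<le> b + 2 * k \<and> b \<le> m"
  shows "a \<in> nbrs Q \<or> b \<in> nbrs Q"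
proof -
  let ?A = "(\<lambda>q. 1 + 2 * q) ` {0..k} \<union> (\<lambda>q. m - 2 * q) ` {0..k}"
  have A: "c \<in> ?A" if "odd c \<and> c \<le> 2 * k + 1 \<or> even c \<and> m \<le> c + 2 * k \<and> c \<le> m" for c
  proof (cases "odd c")
    case True
    with that have "c = 1 + 2 * (c div 2)" "c div 2 \<in> {0..k}" by auto
    then show ?thesis by blast
  next
    case False
    with that \<open>even m\<close> have "c = m - 2 * ((m - c) div 2)" "(m - c) div 2 \<in> {0..k}" by auto
    then show ?thesis by blast
  qed
  have "nbrs Q \<subseteq> ?A"
  proof
    fix i assume i: "i \<in> nbrs Q"
    show "i \<in> ?A"
    proof (cases "odd i")
      case True
      then have "i \<in> par_nbrs Q False" using i by (simp add: par_nbrs_def)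
      then show ?thesis
        using odd_par_nbrs_subset[OF assms(1)] step_eq_2 by auto
    next
      case False
      then have "i \<in> par_nbrs Q True" "m \<in> par_nbrs Q True" "i \<le> m"
        using i assms by (auto simp: par_nbrs_def)
      then obtain q where "q \<le> k" "m = i + step * q"
        using par_nbrs_step[OF assms(1)] by metis
      then show ?thesis using A[of i] False step_eq_2 by auto
    qed
  qed
  moreover have "card ?A \<le> Suc (card (nbrs Q))"
  proof -
    have "card ?A \<le> card {0..k} + card {0..k}"
      using card_Un_le card_image_le by (meson add_mono finite_atLeastAtMost order_trans)
    then show ?thesis using card_nbrs[OF assms(1)] by simp
  qed
  ultimately show ?thesis
    using mem_if_card_le_Suc[of ?A "nbrs Q" a b] A[OF ab(2)] A[OF ab(3)] ab(1) by simp
qed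

lemma widest_le:
  assumes "widest P m"
  shows "m = 2 * k + 1 \<or> m = 2 * k + 2"
proof -
  have P: "longest P" and m: "m \<in> nbrs P" and sub: "\<And>Q. longest Q \<Longrightarrow> nbrs Q \<subseteq> {1..m}"
    using assms by (auto simp: widest_def)
  have "card (nbrs P) \<le> card {1..m}" using sub[OF P] by (intro card_mono) auto
  then have ge: "2 * k + 1 \<le> m" using card_nbrs[OF P] by simp
  have odd: "m \<le> 2 * k + 1" if "odd m"
    using odd_par_nbrs_subset[OF P] m that step_eq_2 by (auto simp: par_nbrs_def)
  have "\<not> 2 * k + 4 \<le> m"
  proof
    assume big: "2 * k + 4 \<le> m"
    then have even: "even m" using odd by fastforce
    note len = nbrs_length[OF m]
    let ?R = "rot m P"
    have R: "longest ?R" using longest_rot[OF P m] .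
    \<comment> \<open>The path edge from \<open>P ! (m - 1)\<close> to \<open>P ! m\<close> keeps
      \<open>m\<close> a neighbour position, so the covering lemma also applies to
      \<open>?R\<close>.\<close>
    have mR: "m \<in> nbrs ?R" using step_nbr[OF P m] .
    note coverP = widest_nbrs_cover[OF P m sub[OF P] even]
    note coverR = widest_nbrs_cover[OF R mR sub[OF R] even]
    have notL: "2 * k + 4 \<notin> L" using L_le by fastforce
    let ?E = "\<lambda>i j. adj (P ! i) (P ! j)"
    have path: "path P" using longest_path[OF P] .
    have no_cycle: False
      if "successively ?E is" "length is = 2 * k + 4" "distinct is" "set is \<subseteq> {..<length P}"
        "?E (last is) (hd is)" for "is"
      using index_cycle_L[OF path that(3,4,1,5)] that(2) notL by simp
    have edges: "?E m 0" "?E 0 m" "?E m (m - 1)" "?E 0 1" "?E 1 0" "?E 2 1" "?E 3 2"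
      using nbrs_adj[OF m] path_step[OF path, of "m - 1"] path_step[OF path, of 0]
        path_step[OF path, of 1] path_step[OF path, of 2] len big adj_sym
      by (auto simp: eval_nat_numeral)
    text \<open>
      Each of the three cycles of length \<open>2k + 4\<close> needs one particular neighbour of \<open>P ! 0\<close> and one of
      \<open>P ! (m - 1)\<close>.  Either vertex lacks at most one of its three, so one cycle is present.
    \<close>
    have Z1: False if "2 * k + 1 \<in> nbrs ?R" "m - 2 \<in> nbrs P"
    proof -
      \<comment> \<open>Position \<open>i < m\<close> on \<open>?R\<close> is
        \<open>m - 1 - i\<close> on \<open>P\<close>: here \<open>2 * k + 1\<close> becomes
        \<open>m - 2 * k - 2\<close>; in the next two cases \<open>m - 2\<close> becomes 1 and
        \<open>m - 4\<close> becomes 3.\<close>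
      have "?E (m - 1) (m - 2 * k - 2)" "?E (m - 2) 0"
        using nbrs_rot_adj[OF m that(1)] nbrs_adj[OF that(2)] adj_sym big by auto
      then have "successively ?E ([0, m, m - 1] @ [m - 2 * k - 2..<m - 1])"
        using edges big path_successively_upt[OF path] len
        by (simp add: successively_append_iff successively_Cons del: upt_Suc)
      moreover have "length ([0, m, m - 1] @ [m - 2 * k - 2..<m - 1]) = 2 * k + 4"
        using big by simp
      moreover have "distinct ([0, m, m - 1] @ [m - 2 * k - 2..<m - 1])" "set ([0, m, m - 1] @ [m - 2 * k - 2..<m - 1]) \<subseteq> {..<length P}"
        using big len by auto
      moreover have "?E (last ([0, m, m - 1] @ [m - 2 * k - 2..<m - 1])) (hd ([0, m, m - 1] @ [m - 2 * k - 2..<m - 1]))"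
      proof -
        have "m - 2 * k - 2 < m - 1" "m - 1 - 1 = m - 2" using big by auto
        then have "last ([0, m, m - 1] @ [m - 2 * k - 2..<m - 1]) = m - 2"
          by (metis last_appendR last_upt upt_eq_Nil_conv not_less_zero order_less_irrefl linorder_not_le)
        then show ?thesis
          using \<open>?E (m - 2) 0\<close> by (simp only: append_Cons list.sel)
      qed
      ultimately show False
        by (rule no_cycle)
    qed
    have Z2: False if "2 * k + 1 \<in> nbrs P" "m - 2 \<in> nbrs ?R"
    proof -
      have "?E (m - 1) 1" "?E (2 * k + 1) 0"
        using nbrs_rot_adj[OF m that(2)] nbrs_adj[OF that(1)] adj_sym big by auto
      then have "successively ?E ([0, m, m - 1] @ [1..<2 * k + 2])"
        using edges big path_successively_upt[OF path] len
        by (simp add: successively_append_iff successively_Cons del: upt_Suc)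
      moreover have "length ([0, m, m - 1] @ [1..<2 * k + 2]) = 2 * k + 4"
        using big by simp
      moreover have "distinct ([0, m, m - 1] @ [1..<2 * k + 2])" "set ([0, m, m - 1] @ [1..<2 * k + 2]) \<subseteq> {..<length P}"
        using big len by auto
      moreover have "?E (last ([0, m, m - 1] @ [1..<2 * k + 2])) (hd ([0, m, m - 1] @ [1..<2 * k + 2]))"
        using edges \<open>?E (2 * k + 1) 0\<close> big by (simp del: upt_Suc)
      ultimately show False
        by (rule no_cycle)
    qed
    have Z3: False if "m - 4 \<in> nbrs ?R" "m - 2 * k \<in> nbrs P"
    proof -
      have "?E (m - 1) 3" "?E 0 (m - 2 * k)"
        using nbrs_rot_adj[OF m that(1)] nbrs_adj[OF that(2)] adj_sym big k_ge_3 by auto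
      then have "successively ?E ([m - 2 * k..<m] @ [3, 2, 1, 0])"
        using edges big k_ge_3 path_successively_upt[OF path] len
        by (simp add: successively_append_iff successively_Cons del: upt_Suc)
      moreover have "length ([m - 2 * k..<m] @ [3, 2, 1, 0]) = 2 * k + 4"
        using big by simp
      moreover have "distinct ([m - 2 * k..<m] @ [3, 2, 1, 0])" "set ([m - 2 * k..<m] @ [3, 2, 1, 0]) \<subseteq> {..<length P}"
        using big len by auto
      moreover have "?E (last ([m - 2 * k..<m] @ [3, 2, 1, 0])) (hd ([m - 2 * k..<m] @ [3, 2, 1, 0]))"
        using \<open>?E 0 (m - 2 * k)\<close> big k_ge_3 k_ge_3 by (simp del: upt_Suc)
      ultimately show False
        by (rule no_cycle)
    qed
    have "2 * k + 1 \<in> nbrs P \<or> m - 2 \<in> nbrs P" "2 * k + 1 \<in> nbrs P \<or> m - 2 * k \<in> nbrs P"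
      "m - 2 \<in> nbrs P \<or> m - 2 * k \<in> nbrs P"
      using even big k_ge_3 by (intro coverP; presburger)+
    moreover have "2 * k + 1 \<in> nbrs ?R \<or> m - 2 \<in> nbrs ?R" "2 * k + 1 \<in> nbrs ?R \<or> m - 4 \<in> nbrs ?R"
      "m - 2 \<in> nbrs ?R \<or> m - 4 \<in> nbrs ?R"
      using even big k_ge_3 by (intro coverR; presburger)+
    ultimately show False using Z1 Z2 Z3 by blast
  qed
  moreover have "m \<noteq> 2 * k + 3" using odd by auto
  ultimately show ?thesis using ge by linarith
qed

section \<open>A closed initial segment and the order of the graph\<close>

lemma take_rot:
  assumes "x \<le> n"
  shows "take n (rot x P) = rot x (take n P)"
  using assms by (cases "x \<le> length P") (simp_all add: rot_def min_absorb1 drop_take)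

lemma hull_closed:
  assumes P: "widest P m" and j: "j < m" and w: "adj (P ! j) w"
  shows "w \<in> set (take (Suc m) P)"
proof -
  have lP: "longest P" and m: "m \<in> nbrs P" and sub: "\<And>Q. longest Q \<Longrightarrow> nbrs Q \<subseteq> {1..m}"
    using P by (auto simp: widest_def)
  have len: "m < length P" using nbrs_length[OF m] .
  \<comment> \<open>Rotation keeps \<open>good\<close>: neighbour positions are at most
    \<open>m\<close>, so only the first \<open>m + 1\<close> vertices are permuted. As the first
    vertex of a good path has all its neighbours among these, it suffices to bring
    \<open>P ! j\<close> to the front.\<close>
  define good where "good Q \<longleftrightarrow> longest Q \<and> length Q = length P \<and>
    set (take (Suc m) Q) = set (take (Suc m) P)" for Q
  have good_rot: "good (rot x Q)" if "good Q" "x \<in> nbrs Q" for x Q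
    using that sub[of Q] longest_rot[of Q x]
    by (auto simp: good_def take_rot)
  have good_nbr: "w \<in> set (take (Suc m) P)" if Q: "good Q" "adj (Q ! 0) w" for Q
  proof -
    obtain i where i: "i < length Q" "w = Q ! i"
      using longest_hd_nbr[of Q w] Q by (auto simp: good_def in_set_conv_nth)
    then have "i \<in> nbrs Q" using Q by (simp add: nbrs_def)
    then have "i \<le> m" using sub[of Q] Q by (auto simp: good_def)
    then have "w \<in> set (take (Suc m) Q)"
      using i by (auto simp: in_set_conv_nth intro!: exI[of _ i])
    then show ?thesis using Q by (simp add: good_def)
  qed
  \<comment> \<open>At least \<open>2 * k + 1\<close> of the \<open>m \<le> 2 * k + 2\<close>
    positions are taken, so at most one is missing.\<close>
  have cover: "a \<in> nbrs Q \<or> b \<in> nbrs Q"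
    if "longest Q" "a \<in> {1..m}" "b \<in> {1..m}" "a \<noteq> b" for Q a b
    using mem_if_card_le_Suc[OF _ sub[OF that(1)], of a b] card_nbrs[OF that(1)] widest_le[OF P] that
    by auto
  have ne: "P \<noteq> []" using len by auto
  have gP: "good P" using lP by (simp add: good_def)
  have "\<exists>Q. good Q \<and> Q ! 0 = P ! j"
  proof (cases "Suc j \<in> nbrs P")
    case True
    then show ?thesis
      using good_rot[OF gP True] rot_nth_0[OF True] by auto
  next
    case False
    then have "Suc j \<noteq> m" "j \<noteq> 0" using m one_in_nbrs[OF lP] by (auto intro: gr0I)
    then have j': "1 \<le> j" "Suc j < m" using j by auto
    have X: "i \<in> nbrs P" if "i \<in> {1..m}" "i \<noteq> Suc j" for i
      using cover[OF lP that(1), of "Suc j"] that j' False by auto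
    text \<open>\<open>P ! j\<close> is not the end of a rotation of \<open>P\<close>, but of a twofold rotation.\<close>
    show ?thesis
    proof (cases "j = 1")
      case True
      \<comment> \<open>Here \<open>Suc j\<close> is 2, so the general choice below fails. Rotation
        at 4 moves \<open>P ! 1\<close> to index 2 and \<open>P ! 0\<close> to index 3, and
        \<open>P ! 0\<close> is adjacent to the new first vertex \<open>P ! 3\<close>.\<close>
      have x: "4 \<in> nbrs P" using X[of 4] True widest_le[OF P] k_ge_3 by auto
      have len4: "4 < length P" using nbrs_length[OF x] .
      let ?R = "rot 4 P"
      have "adj (P ! 3) (P ! 0)"
        using X[of 3] True widest_le[OF P] k_ge_3 nbrs_adj[of 3 P] adj_sym by auto
      then have y: "3 \<in> nbrs ?R"
        using nbrs_rot_iff[OF x, of 0] ne by simp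
      then have "good (rot 3 ?R)" using good_rot good_rot[OF gP x] by blast
      moreover have "rot 3 ?R ! 0 = P ! j"
        using rot_nth_0[OF y] len4 True by (simp add: nth_rot)
      ultimately show ?thesis by blast
    next
      case False
      let ?R = "rot (j + 2) P"
      have x: "j + 2 \<in> nbrs P" using X[of "j + 2"] j' by auto
      have lenj: "j + 2 < length P" using nbrs_length[OF x] .
      have R: "longest ?R" using longest_rot[OF lP x] .
      \<comment> \<open>On \<open>?R\<close> the vertex \<open>P ! j\<close> has index 1 and
        \<open>P ! 0\<close> has index \<open>Suc j\<close>. The latter is the one missing neighbour
        position, so 2 is present.\<close>
      have "\<not> adj (P ! Suc j) (P ! 0)"
        using \<open>Suc j \<notin> nbrs P\<close> lenj adj_sym by (auto simp: nbrs_def)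
      then have "Suc j \<notin> nbrs ?R"
        using nbrs_rot_iff[OF x, of 0] ne by simp
      then have y: "2 \<in> nbrs ?R"
        using cover[OF R, of "Suc j" 2] j' False by auto
      then have "good (rot 2 ?R)" using good_rot good_rot[OF gP x] by blast
      moreover have "rot 2 ?R ! 0 = P ! j"
        using rot_nth_0[OF y] lenj by (simp add: nth_rot)
      ultimately show ?thesis by blast
    qed
  qed
  then show ?thesis using good_nbr w by metis
qed

text \<open>By \<open>hull_closed\<close>, edges from the first \<open>m\<close> vertices lead only
  to these and to \<open>P ! m\<close>. So \<open>no_cut\<close> with \<open>z = P ! m\<close>
  leaves no further vertex, and there are at most \<open>m + 1\<close>.\<close>

theorem card_V_le:
  assumes no_cut: "\<And>z S. S \<noteq> {} \<Longrightarrow> S \<subset> V - {z} \<Longrightarrow> \<exists>u\<in>S. \<exists>w\<in>V - {z} - S. adj u w"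
  shows "card V \<le> 2 * k + 3"
proof -
  obtain P m where P: "widest P m" using ex_widest by blast
  then have m: "m < length P" "1 \<le> m" and pP: "path P"
    using nbrs_length nbrs_pos longest_path by (auto simp: widest_def)
  let ?W = "set (take (Suc m) P)" and ?S = "set (take m P)"
  have W: "?W = insert (P ! m) ?S" using m by (simp add: take_Suc_conv_app_nth)
  have "P ! m \<notin> ?S" "?W \<subseteq> V"
    using m pP by (auto simp: path_def in_set_conv_nth nth_eq_iff_index_eq dest: in_set_takeD)
  moreover have "?S \<noteq> {}" using m by auto
  moreover have "\<not> (\<exists>u\<in>?S. \<exists>w\<in>V - {P ! m} - ?S. adj u w)"
  proof (rule notI, elim bexE)
    fix u w assume "u \<in> ?S" "w \<in> V - {P ! m} - ?S" "adj u w"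
    moreover from this obtain j where "j < m" "u = P ! j" by (auto simp: in_set_conv_nth)
    ultimately show False using hull_closed[OF P] W by blast
  qed
  ultimately have "V - {P ! m} = ?S"
    using no_cut[of ?S "P ! m"] W by blast
  then have "V \<subseteq> ?W" using W by auto
  then have "card V \<le> length (take (Suc m) P)"
    by (meson card_length card_mono finite_set order_trans)
  then show ?thesis using widest_le[OF P] by auto
qed

end

section \<open>Cycles, degrees and connectivity in the digraph\<close>

lemma (in wf_digraph) awalk_of_successively:
  assumes "vs \<noteq> []" "hd vs \<in> verts G" "successively (\<lambda>u v. (u, v) \<in> arcs_ends G) vs"
  shows "\<exists>p. awalk (hd vs) p (last vs) \<and> awalk_verts (hd vs) p = vs"
  using assms
proof (induction vs rule: induct_list012)
  case (2 v)
  then show ?case by (intro exI[of _ "[]"]) (simp add: awalk_Nil_iff)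
next
  case (3 u v vs)
  then obtain e where e: "e \<in> arcs G" "tail G e = u" "head G e = v"
    by auto
  with 3 obtain p where p: "awalk v p (last (v # vs))" "awalk_verts v p = v # vs"
    by auto
  then have "awalk u (e # p) (last (u # v # vs))" "awalk_verts u (e # p) = u # v # vs"
    using e by (auto simp: awalk_Cons_iff)
  then show ?case by (metis list.sel(1))
qed simp

lemma (in wf_digraph) cycle_of_successively:
  assumes "vs \<noteq> []" "distinct vs" "successively (\<lambda>u v. (u, v) \<in> arcs_ends G) vs" "(last vs, hd vs) \<in> arcs_ends G"
  shows "\<exists>p. cycle p \<and> length p = length vs"
proof -
  obtain e where e: "e \<in> arcs G" "tail G e = last vs" "head G e = hd vs"
    using assms(4) by auto
  have "hd vs \<in> verts G" using head_in_verts[OF e(1)] e(3) by simp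
  then obtain p where p: "awalk (hd vs) p (last vs)" "awalk_verts (hd vs) p = vs"
    using awalk_of_successively assms by blast
  have "awalk (hd vs) (p @ [e]) (hd vs)"
    using p(1) e by (auto simp: awalk_Cons_iff awalk_Nil_iff)
  moreover from this have "awalk_verts (hd vs) (p @ [e]) = vs @ [hd vs]"
    using p e by (simp add: awalk_verts_append)
  moreover have "distinct (tl (vs @ [hd vs]))"
    using assms(1,2) by (cases vs) auto
  ultimately have "cycle (p @ [e])" unfolding cycle_def by force
  moreover have "length (p @ [e]) = length vs"
    using p(2) length_awalk_verts[of "hd vs" p] by simp
  ultimately show ?thesis by blast
qed

text \<open>Makes the set of even cycle lengths finite.\<close>

lemma (in fin_digraph) cycle_length_le:
  assumes "cycle p"
  shows "length p \<le> card (verts G)"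
proof -
  obtain u where u: "awalk u p u" "distinct (tl (awalk_verts u p))"
    using assms by (auto simp: cycle_def)
  have "set (tl (awalk_verts u p)) \<subseteq> verts G"
    using u(1) awalk_verts_in_verts[of u p] list.set_sel(2)[of "awalk_verts u p"]
    by (auto simp: awalk_def)
  then have "card (set (tl (awalk_verts u p))) \<le> card (verts G)"
    by (intro card_mono) auto
  then show ?thesis
    using distinct_card[OF u(2)] length_awalk_verts[of u p] by simp
qed

lemma (in digraph) out_degree_eq_card: "out_degree G v = card {w. (v, w) \<in> arcs_ends G}"
proof -
  have "{w. (v, w) \<in> arcs_ends G} = head G ` out_arcs G v"
    by (auto simp: arcs_ends_conv)
  moreover have "inj_on (head G) (out_arcs G v)"
    by (auto intro!: inj_onI no_multi_arcs simp: arc_to_ends_def)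
  ultimately show ?thesis by (simp add: out_degree_def card_image)
qed

lemma (in graph) ex_boundary_arc_if_2_connected:
  assumes "k_connected 2 G" "S \<noteq> {}" "S \<subset> verts G - {z}"
  shows "\<exists>u\<in>S. \<exists>w\<in>verts G - {z} - S. (u, w) \<in> arcs_ends G"
proof (rule ccontr)
  assume no: "\<not> ?thesis"
  let ?H = "G \<restriction> (verts G - {z})"
  \<comment> \<open>\<open>z\<close> may lie outside the graph, whereas \<open>k_connected\<close>
    removes subsets of the vertices only.\<close>
  have "verts G - {z} = verts G - ({z} \<inter> verts G)" by auto
  moreover have "card ({z} \<inter> verts G) < 2"
    by (rule le_less_trans[OF card_mono[of "{z}"]]) auto
  ultimately have "connected ?H"
    using assms(1) unfolding k_connected_def by (metis Int_lower2)
  moreover obtain u w where uw: "u \<in> S" "w \<in> verts G - {z} - S" using assms(2,3) by auto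
  ultimately have "u \<rightarrow>\<^sup>*\<^bsub>mk_symmetric ?H\<^esub> w"
    using assms(3) unfolding connected_def strongly_connected_def by auto
  then have "(u, w) \<in> rtrancl_on (verts G - {z}) (parcs (mk_symmetric ?H))"
    by (simp add: reachable_def)
  then have "w \<in> S"
  proof (induction rule: rtrancl_on_induct)
    case (step v w)
    then have "(v, w) \<in> arcs_ends G"
      using arcs_ends_symmetric[OF sym_arcs] by (fastforce simp: parcs_mk_symmetric arcs_ends_conv)
    then show ?case using no step by blast
  qed (use uw in simp)
  then show False using uw by simp
qed

section \<open>Cliques and colourings when non-edges form a matching\<close>

lemma (in graph) contains_complete_if_pairwise_adjacent:
  assumes "W \<subseteq> verts G" "card W = n" "\<And>u v. u \<in> W \<Longrightarrow> v \<in> W \<Longrightarrow> u \<noteq> v \<Longrightarrow> (u, v) \<in> arcs_ends G"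
  shows "contains_complete n G"
proof -
  let ?H = "G \<restriction> W"
  have "finite W" using assms(1) finite_verts by (rule finite_subset)
  moreover have "symmetric ?H"
    using sym_arcs unfolding symmetric_conv by fastforce
  ultimately have "graph ?H"
    by unfold_locales (auto simp: no_loops arc_to_ends_def intro: no_multi_arcs)
  moreover have "arcs_ends ?H = {(u, v). (u, v) \<in> W \<times> W \<and> u \<noteq> v}"
    using assms(3) by (force simp: arcs_ends_conv dest: no_loops)
  ultimately have "complete_digraph n ?H"
    using assms(2) by (simp add: complete_digraph_def)
  moreover have "subgraph ?H G"
    using assms(1) by (intro induced_imp_subgraph induced_induce)
  ultimately show ?thesis by (auto simp: contains_complete_def)
qed

text \<open>Without a clique on \<open>n + 1\<close> vertices there are two disjoint non-edges among
  exactly \<open>n + 2\<close> vertices, and each lets two vertices share a colour.\<close>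

lemma (in graph) complete_or_colourable:
  assumes deg: "\<And>v. v \<in> verts G \<Longrightarrow> n \<le> card {w. (v, w) \<in> arcs_ends G}"
    and ne: "verts G \<noteq> {}" and card: "card (verts G) \<le> n + 2"
  shows "contains_complete (n + 1) G \<or> chromatic_number G \<le> n"
proof (cases "contains_complete (n + 1) G")
  case False
  \<comment> \<open>Two non-neighbours besides \<open>u\<close> itself would leave at most
    \<open>n - 1\<close> neighbours.\<close>
  have nadj: "x \<in> {u, v} \<or> (u, x) \<in> arcs_ends G" if "u \<in> verts G" "v \<in> verts G" "u \<noteq> v" "(u, v) \<notin> arcs_ends G" "x \<in> verts G"
    for u v x
  proof (rule ccontr)
    assume "\<not> ?thesis"
    then have sub: "{w. (u, w) \<in> arcs_ends G} \<subseteq> verts G - {u, v, x}" and "card {u, v, x} = 3"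
      using that adj_not_same adj_in_verts by (auto simp: card_insert_if)
    have "card (verts G - {u, v, x}) = card (verts G) - 3"
      using \<open>card {u, v, x} = 3\<close> that by (subst card_Diff_subset) auto
    moreover have "card {u, v, x} \<le> card (verts G)"
      using that by (intro card_mono) auto
    ultimately show False
      using deg[OF that(1)] card_mono[OF _ sub] card \<open>card {u, v, x} = 3\<close> by auto
  qed
  have pair: "\<exists>u\<in>W. \<exists>v\<in>W. u \<noteq> v \<and> (u, v) \<notin> arcs_ends G" if W: "W \<subseteq> verts G" "n + 1 \<le> card W" for W
  proof (rule ccontr)
    assume *: "\<not> ?thesis"
    obtain U where "U \<subseteq> W" "card U = n + 1" using obtain_subset_with_card_n[OF W(2)] by metis
    then show False
      using contains_complete_if_pairwise_adjacent[of U "n + 1"] * W False by blast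
  qed
  obtain v where v: "v \<in> verts G" using ne by auto
  have "{w. (v, w) \<in> arcs_ends G} \<subseteq> verts G - {v}" using adj_not_same by auto
  then have "n \<le> card (verts G - {v})"
    using deg[OF v] card_mono by (metis finite_Diff finite_verts order_trans)
  then have "n + 1 \<le> card (verts G)" using v card_Suc_Diff1[of "verts G" v] by simp
  then obtain a b where ab: "a \<in> verts G" "b \<in> verts G" "a \<noteq> b" "(a, b) \<notin> arcs_ends G"
    using pair by blast
  have "{w. (a, w) \<in> arcs_ends G} \<subseteq> verts G - {a, b}" using ab adj_not_same by auto
  then have "n \<le> card (verts G - {a, b})"
    using deg[OF ab(1)] card_mono by (metis finite_Diff finite_verts order_trans)
  moreover have "card (verts G - {a, b}) = card (verts G) - 2"
    using ab by (subst card_Diff_subset) auto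
  moreover have "card {a, b} \<le> card (verts G)"
    using ab by (intro card_mono) auto
  ultimately have cV: "card (verts G) = n + 2" using ab(3) card by simp
  \<comment> \<open>The \<open>n + 1\<close> vertices other than \<open>b\<close> form no clique
    either; their non-edge avoids \<open>a\<close>, whose only non-neighbour besides itself is
    \<open>b\<close>.\<close>
  then have "n + 1 \<le> card (verts G - {b})" using ab by simp
  then obtain c d where cd: "c \<in> verts G" "d \<in> verts G" "c \<noteq> b" "d \<noteq> b" "c \<noteq> d" "(c, d) \<notin> arcs_ends G"
    using pair[of "verts G - {b}"] by blast
  have sym: "(u, w) \<in> arcs_ends G" if "(w, u) \<in> arcs_ends G" for u w
    using that arcs_ends_symmetric[OF sym_arcs] by blast
  have ne_acd: "c \<noteq> a" "d \<noteq> a"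
    using nadj[OF ab, of d] nadj[OF ab, of c] cd ab sym by auto
  let ?W = "verts G - {b, d}"
  have "card ?W = n" using cV ab cd by (subst card_Diff_subset) auto
  then obtain f where f: "bij_betw f ?W {0..<n}"
    using ex_bij_betw_finite_nat[of ?W] by auto
  then have inj: "f u = f w \<longleftrightarrow> u = w" if "u \<in> ?W" "w \<in> ?W" for u w
    using that by (auto simp: bij_betw_def inj_on_eq_iff)
  have lt: "f u < n" if "u \<in> ?W" for u
    using that f by (auto simp: bij_betw_def)
  \<comment> \<open>The other \<open>n\<close> vertices get distinct colours; \<open>b\<close> and
    \<open>d\<close> reuse those of their non-neighbours \<open>a\<close> and
    \<open>c\<close>.\<close>
  define col where "col = f(b := f a, d := f c)"
  have "proper_colouring G n col"
    unfolding proper_colouring_def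
  proof (intro conjI ballI)
    fix v assume "v \<in> verts G"
    then show "col v < n" using lt[of v] lt[of a] lt[of c] ab cd ne_acd by (auto simp: col_def)
  next
    fix e assume "e \<in> arcs_ends G"
    obtain u w where e: "e = (u, w)" by (cases e)
    then have uw: "(u, w) \<in> arcs_ends G" "(w, u) \<in> arcs_ends G" "u \<noteq> w" "u \<in> verts G" "w \<in> verts G"
      using \<open>e \<in> arcs_ends G\<close> sym adj_not_same adj_in_verts by auto
    have "col u \<noteq> col w"
      using uw ab cd ne_acd inj[of u w] inj[of a w] inj[of u a] inj[of c w] inj[of u c] inj[of a c]
        sym[of a b] sym[of c d]
      by (auto simp: col_def split: if_splits)
    then show "case e of (u, v) \<Rightarrow> col u \<noteq> col v" using e by simp
  qed
  then have "chromatic_number G \<le> n"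
    unfolding chromatic_number_def by (intro Least_le) blast
  then show ?thesis ..
qed simp

section \<open>Conclusion for 2-connected graphs\<close>

theorem theorem8:
  fixes G :: "('a, 'b) pre_digraph" and k :: nat
  assumes "graph G"
    and "k \<ge> 3"
    and "k_connected 2 G"
    and "min_degree G \<ge> 2 * k + 1"
  shows "card (even_cycle_lengths G) \<ge> k \<and>
    (card (even_cycle_lengths G) = k \<longrightarrow>
      2 * card (even_cycle_lengths G) + 2 = longest_even_cycle_length G \<and>
      (contains_complete (2 * k + 2) G \<or> chromatic_number G \<le> 2 * k + 1))"
proof -
  interpret graph G by fact
  let ?L = "even_cycle_lengths G"
  have ne: "verts G \<noteq> {}" using assms(3) by (auto simp: k_connected_def)
  have deg: "2 * k + 1 \<le> card {w. (v, w) \<in> arcs_ends G}" if "v \<in> verts G" for v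
  proof -
    have "min_degree G \<le> out_degree G v" unfolding min_degree_def using that by simp
    then show ?thesis using assms(4) by (simp add: out_degree_eq_card)
  qed
  have fin: "finite ?L"
    by (rule finite_subset[of _ "{..card (verts G)}"])
      (auto simp: even_cycle_lengths_def intro: cycle_length_le)
  interpret dense_graph "verts G" "\<lambda>u v. (u, v) \<in> arcs_ends G" k ?L
  proof
    fix vs :: "'a list"
    assume vs: "distinct vs" "successively (\<lambda>u v. (u, v) \<in> arcs_ends G) vs" "(last vs, hd vs) \<in> arcs_ends G"
      "4 \<le> length vs" "even (length vs)"
    then have "vs \<noteq> []" by auto
    then obtain p where "cycle p" "length p = length vs"
      using cycle_of_successively vs by blast
    then show "length vs \<in> ?L"
      using vs(4,5) by (auto simp: even_cycle_lengths_def intro!: exI[of _ p])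
  qed (use ne deg fin adj_not_same arcs_ends_symmetric[OF sym_arcs] adj_in_verts in auto)
  show ?thesis
  proof (intro conjI impI)
    show "k \<le> card ?L" by (rule card_L)
    assume eq: "card ?L = k"
    interpret extremal_graph "verts G" "\<lambda>u v. (u, v) \<in> arcs_ends G" k ?L
      by unfold_locales (use eq assms(2) in auto)
    have "Max ?L = 2 * k + 2"
      unfolding L_eq using assms(2) by (intro Max_eqI) auto
    then show "2 * card ?L + 2 = longest_even_cycle_length G"
      using eq by (simp add: longest_even_cycle_length_def)
    have "card (verts G) \<le> 2 * k + 3"
      using card_V_le ex_boundary_arc_if_2_connected[OF assms(3)] by blast
    \<comment> \<open>With \<open>n = 2 * k + 1\<close> the bound \<open>2 * k + 3\<close> on the
      order is \<open>n + 2\<close>.\<close>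
    then show "contains_complete (2 * k + 2) G \<or> chromatic_number G \<le> 2 * k + 1"
      using complete_or_colourable[OF deg ne] by simp
  qed
qed

end
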